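(* The distribution of the descent set over all Motzkin paths is the same for the orderings $U>D>L$, $U>L>D$ and $L>U>D$. That is, for every $n$ and every $S\subseteq[n-1]$, the three numbers $$\#\{M\in\mathbf M_n:\mathrm{Des}_{U>D>L}(M)=S\},\quad \#\{M\in\mathbf M_n:\mathrm{Des}_{U>L>D}(M)=S\},\quad \#\{M\in\mathbf M_n:\mathrm{Des}_{L>U>D}(M)=S\}$$ are equal.
   Context: A Motzkin path of length $n$ is a lattice path from $(0,0)$ to $(n,0)$ with $n$ steps from $U=(1,1)$, $D=(1,-1)$, $L=(1,0)$ that never passes below the $x$-axis. $\mathbf M_n$ is the set of Motzkin paths of length $n$, and $[n-1]=\{1,\dots,n-1\}$. For a total order on the three step types $U,D,L$, the descent set of $M\in\mathbf M_n$ with respect to this order is the set of $i\in[n-1]$ such that the $i$th step of $M$ is strictly larger in the order than the $(i+1)$st step of $M$; it is denoted $\mathrm{Des}$ with the order as subscript. *)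

theory Defs
  imports Main "HOL-Library.Product_Plus"
begin

datatype step = U | D | L

fun step_vec :: "step \<Rightarrow> int \<times> int" where
  "step_vec U = (1, 1)"
| "step_vec D = (1, -1)"
| "step_vec L = (1, 0)"

text \<open>A lattice path starting at the origin is given by its list of steps; \<open>path_point M k\<close> is
  the lattice point reached after the first \<open>k\<close> steps.\<close>

definition path_point :: "step list \<Rightarrow> nat \<Rightarrow> int \<times> int" where
  "path_point M k = sum_list (map step_vec (take k M))"

definition motzkin_paths :: "nat \<Rightarrow> step list set" where
  "motzkin_paths n =
     {M. length M = n \<and> path_point M n = (int n, 0) \<and> (\<forall>k\<le>n. 0 \<le> snd (path_point M k))}"

text \<open>A total order on the steps is represented by its strict part, read downwards:
  \<open>(x, y) \<in> gt\<close> means that \<open>x\<close> is strictly larger than \<open>y\<close>. The relation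
  \<open>order_gt a b c\<close> is the order \<open>a > b > c\<close>.\<close>

definition order_gt :: "step \<Rightarrow> step \<Rightarrow> step \<Rightarrow> step rel" where
  "order_gt a b c = {(a, b), (a, c), (b, c)}"

text \<open>Positions are counted from 1 as usual for descents, so the \<open>i\<close>-th step of \<open>M\<close> is \<open>M ! (i - 1)\<close>.\<close>

definition Des :: "step rel \<Rightarrow> step list \<Rightarrow> nat set" where
  "Des gt M = {i \<in> {1..length M - 1}. (M ! (i - 1), M ! i) \<in> gt}"

lemma strict_linear_order_order_gt:
  assumes "distinct [a, b, c]"
  shows "strict_linear_order (order_gt a b c)"
proof -
  have "x = a \<or> x = b \<or> x = c" for x
    using assms by (cases a; cases b; cases c; cases x) auto
  then show ?thesis
    using assms unfolding strict_linear_order_on_def order_gt_def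
    by (auto simp: trans_def irrefl_def total_on_def) metis+
qed

lemma finite_motzkin_paths: "finite (motzkin_paths n)"
proof -
  have "(UNIV :: step set) = {U, D, L}"
    using step.exhaust by auto
  then have "finite (UNIV :: step set)"
    by (metis finite.emptyI finite.insertI)
  then have "finite {M :: step list. set M \<subseteq> UNIV \<and> length M = n}"
    by (rule finite_lists_length_eq)
  then show ?thesis
    by (rule rev_finite_subset) (auto simp: motzkin_paths_def)
qed

end

theory Submission
  imports Defs "HOL-Library.Multiset"
begin

text \<open>By inclusion-exclusion it suffices to count the paths whose descent set is contained in \<open>S\<close>.
  Such a path is cut by \<open>S\<close> into weakly increasing blocks, so it is determined by the multiset of
  steps in each block. In all three orders \<open>D < U\<close>, hence within a block every down step precedes
  every up step, and nonnegativity of the path says that the height at the start of each block is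
  at least the number of down steps of the block. This condition on the multisets does not depend
  on the order.\<close>

text \<open>The inclusion-exclusion is carried out as an induction on \<open>S\<close>: the count
  for \<open>\<subseteq> S\<close> is the count for \<open>= S\<close> plus the counts for the
  proper subsets of \<open>S\<close>, which agree by induction and cancel.\<close>

lemma card_fibre_eq_if_card_subset_eq:
  assumes fin: "finite A" "finite B"
    and le: "\<And>T. card {x \<in> A. d x \<subseteq> T} = card {x \<in> B. e x \<subseteq> T}"
    and "finite S"
  shows "card {x \<in> A. d x = S} = card {x \<in> B. e x = S}"
  using \<open>finite S\<close>
proof (induction S rule: finite_psubset_induct)
  case (psubset S)
  have split: "card {x \<in> C. g x \<subseteq> S} =
      card {x \<in> C. g x = S} + (\<Sum>T\<in>Pow S - {S}. card {x \<in> C. g x = T})"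
    if "finite C" for C :: "'z set" and g
  proof -
    have "{x \<in> C. g x \<subseteq> S} = (\<Union>T\<in>Pow S. {x \<in> C. g x = T})"
      by auto
    also have "card \<dots> = (\<Sum>T\<in>Pow S. card {x \<in> C. g x = T})"
      using that psubset.hyps by (intro card_UN_disjoint) auto
    also have "\<dots> = card {x \<in> C. g x = S} + (\<Sum>T\<in>Pow S - {S}. card {x \<in> C. g x = T})"
      using psubset.hyps by (intro sum.remove) auto
    finally show ?thesis .
  qed
  have "(\<Sum>T\<in>Pow S - {S}. card {x \<in> A. d x = T}) = (\<Sum>T\<in>Pow S - {S}. card {x \<in> B. e x = T})"
    by (intro sum.cong refl psubset.IH) auto
  then show ?case
    using split[OF fin(1), of d] split[OF fin(2), of e] le[of S] by simp
qed

text \<open>Here \<open>i\<close> is a list index, counted from 0, while a cut \<open>j > 0\<close>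
  lies between the indices \<open>j - 1\<close> and \<open>j\<close>. So the positive cuts
  \<open>j \<le> i\<close> are those before entry \<open>i\<close>.\<close>

definition block :: "nat set \<Rightarrow> nat \<Rightarrow> nat" where
  "block S i = card (S \<inter> {..i})"

definition blocks :: "nat set \<Rightarrow> nat \<Rightarrow> nat list" where
  "blocks S n = map (block S) [0..<n]"

text \<open>For \<open>f < 3\<close> this encodes the lexicographic order on pairs of a block number and a step.\<close>

definition key :: "(step \<Rightarrow> nat) \<Rightarrow> nat \<times> step \<Rightarrow> nat" where
  "key f p = 3 * fst p + f (snd p)"

text \<open>The height at the start of block \<open>c\<close> is the number of up steps minus the
  number of down steps in earlier blocks. Moving these down steps to the other side of the height
  condition turns the down steps of block \<open>c\<close> into those of all blocks up to
  \<open>c\<close>.\<close>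

definition block_feasible :: "(nat \<times> step) multiset \<Rightarrow> bool" where
  "block_feasible m \<longleftrightarrow>
     size {#p \<in># m. snd p = U#} = size {#p \<in># m. snd p = D#} \<and>
     (\<forall>c. size {#p \<in># m. snd p = D \<and> fst p \<le> c#} \<le> size {#p \<in># m. snd p = U \<and> fst p < c#})"

lemma length_blocks [simp]: "length (blocks S n) = n"
  by (simp add: blocks_def)

lemma block_Suc: "block S (Suc i) = block S i + (if Suc i \<in> S then 1 else 0)"
  by (simp add: block_def atMost_Suc)

lemma sorted_blocks: "sorted (blocks S n)"
  by (simp add: sorted_iff_nth_Suc blocks_def block_Suc)

lemma all_nat_split: "(\<forall>j. P j) \<longleftrightarrow> P 0 \<and> (\<forall>i. P (Suc i))"
  by (metis not0_implies_Suc)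

text \<open>Neighbouring keys compare by block number if a cut separates them and by
  \<open>f\<close> otherwise, so the keys drop exactly at the descents outside
  \<open>S\<close>.\<close>

lemma Des_subset_iff_sorted:
  fixes f :: "step \<Rightarrow> nat"
  assumes "\<And>x. f x < 3"
  shows "Des {(x, y). f y < f x} M \<subseteq> S \<longleftrightarrow>
    sorted (map (key f) (zip (blocks S (length M)) M))"
proof -
  have "Des {(x, y). f y < f x} M \<subseteq> S \<longleftrightarrow>
      (\<forall>j. 1 \<le> j \<and> j \<le> length M - 1 \<longrightarrow> f (M ! j) < f (M ! (j - 1)) \<longrightarrow> j \<in> S)"
    by (auto simp: Des_def)
  also have "\<dots> \<longleftrightarrow> (\<forall>i. Suc i < length M \<longrightarrow> f (M ! Suc i) < f (M ! i) \<longrightarrow> Suc i \<in> S)"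
    by (subst all_nat_split) auto
  finally have "Des {(x, y). f y < f x} M \<subseteq> S \<longleftrightarrow>
      (\<forall>i. Suc i < length M \<longrightarrow> f (M ! Suc i) < f (M ! i) \<longrightarrow> Suc i \<in> S)" .
  moreover have "key f (block S i, x) \<le> key f (block S (Suc i), y) \<longleftrightarrow> (f y < f x \<longrightarrow> Suc i \<in> S)"
    for i x y
    using assms[of x] by (auto simp: key_def block_Suc)
  ultimately show ?thesis
    by (simp add: sorted_iff_nth_Suc blocks_def)
qed

lemma snd_path_point:
  "snd (path_point M k) = int (size {#x \<in># mset (take k M). x = U#}) -
     int (size {#x \<in># mset (take k M). x = D#})"
proof -
  have "snd (sum_list (map step_vec xs)) =
      int (size {#x \<in># mset xs. x = U#}) - int (size {#x \<in># mset xs. x = D#})" for xs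
  proof (induction xs)
    case (Cons x xs)
    then show ?case by (cases x) auto
  qed simp
  then show ?thesis by (simp add: path_point_def)
qed

lemma fst_path_point: "fst (path_point M (length M)) = int (length M)"
proof -
  have "fst (step_vec x) = 1" for x by (cases x) auto
  then have "fst (sum_list (map step_vec xs)) = int (length xs)" for xs
    by (induction xs) auto
  then show ?thesis by (simp add: path_point_def)
qed

lemma motzkin_paths_iff:
  assumes "length ps = n"
  shows "map snd ps \<in> motzkin_paths n \<longleftrightarrow>
    size {#p \<in># mset ps. snd p = U#} = size {#p \<in># mset ps. snd p = D#} \<and>
    (\<forall>k. size {#p \<in># mset (take k ps). snd p = D#} \<le> size {#p \<in># mset (take k ps). snd p = U#})"
proof -
  have *: "size {#x \<in># mset (take k (map snd ps)). x = y#} =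
      size {#p \<in># mset (take k ps). snd p = y#}" for k y
    by (simp add: take_map filter_mset_image_mset)
  have all: "(\<forall>k\<le>n. P (take k ps)) \<longleftrightarrow> (\<forall>k. P (take k ps))" for P
  proof (intro iffI allI impI)
    fix k assume "\<forall>k\<le>n. P (take k ps)"
    then have "P (take (min k n) ps)" by simp
    then show "P (take k ps)" using assms by (simp add: min_def split: if_splits)
  qed simp
  show ?thesis
    using assms fst_path_point[of "map snd ps"] *[where k = n]
      all[of "\<lambda>qs. size {#p \<in># mset qs. snd p = D#} \<le> size {#p \<in># mset qs. snd p = U#}"]
    by (simp add: motzkin_paths_def snd_path_point * prod_eq_iff del: mset_map)
qed

text \<open>Within a block the height is lowest between the down steps and the up steps, so one
  prefix per block needs testing.\<close>

lemma sorted_prefix_iff_block_feasible: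
  assumes f: "\<And>x. f x < 3" "f D < f U" and sorted: "sorted (map (key f) ps)"
  shows "(\<forall>k. size {#p \<in># mset (take k ps). snd p = D#} \<le> size {#p \<in># mset (take k ps). snd p = U#})
    \<longleftrightarrow> (\<forall>c. size {#p \<in># mset ps. snd p = D \<and> fst p \<le> c#} \<le>
          size {#p \<in># mset ps. snd p = U \<and> fst p < c#})" (is "?pre \<longleftrightarrow> ?blk")
proof
  assume ?pre
  show ?blk
  proof
    fix c
    text \<open>The prefix ending just before the up steps of block \<open>c\<close>.\<close>
    define K where "K = 3 * c + f U"
    have "takeWhile (\<lambda>p. key f p < K) ps = filter (\<lambda>p. key f p < K) ps"
      using sorted by (induction ps) (auto simp: filter_empty_conv eq_commute[of "[]"])
    then obtain k where k: "take k ps = filter (\<lambda>p. key f p < K) ps"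
      by (metis takeWhile_eq_take)
    \<comment> \<open>\<open>f D < f U\<close> puts the down steps of block \<open>c\<close> below
      \<open>K\<close>, and \<open>f U < 3\<close> keeps block \<open>c + 1\<close> above
      it.\<close>
    have kD: "key f p < K \<longleftrightarrow> fst p \<le> c" if "snd p = D" for p
      using f(1)[of U] f(2) that by (auto simp: key_def K_def)
    have kU: "key f p < K \<longleftrightarrow> fst p < c" if "snd p = U" for p
      using f(1)[of U] that by (auto simp: key_def K_def)
    have "{#p \<in># mset (take k ps). snd p = D#} = {#p \<in># mset ps. snd p = D \<and> fst p \<le> c#}"
      using kD by (auto simp: k filter_filter_mset intro!: filter_mset_cong)
    moreover have "{#p \<in># mset (take k ps). snd p = U#} = {#p \<in># mset ps. snd p = U \<and> fst p < c#}"
      using kU by (auto simp: k filter_filter_mset intro!: filter_mset_cong)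
    ultimately show "size {#p \<in># mset ps. snd p = D \<and> fst p \<le> c#} \<le>
        size {#p \<in># mset ps. snd p = U \<and> fst p < c#}"
      using \<open>?pre\<close> by metis
  qed
next
  assume ?blk
  show ?pre
  proof
    fix k
    obtain xs ys where xs: "take k ps = xs" and ps: "ps = xs @ ys"
      by (metis append_take_drop_id)
    show "size {#p \<in># mset (take k ps). snd p = D#} \<le> size {#p \<in># mset (take k ps). snd p = U#}"
    proof (cases "xs = []")
      case False
      \<comment> \<open>The block in which the prefix ends: the down steps of the prefix lie in
        blocks up to \<open>c\<close>, and the prefix contains all of the blocks before
        \<open>c\<close>.\<close>
      define c where "c = fst (last xs)"
      have mono: "fst p \<le> fst q" if "key f p \<le> key f q" for p q
        using that f(1)[of "snd p"] f(1)[of "snd q"] by (auto simp: key_def)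
      have ord: "sorted (map (key f) xs)"
        "\<And>p q. p \<in> set xs \<Longrightarrow> q \<in> set ys \<Longrightarrow> key f p \<le> key f q"
        using sorted unfolding ps map_append sorted_append by auto
      have before: "fst p \<le> c" if "p \<in> set xs" for p
      proof -
        have "sorted (map (key f) (butlast xs @ [last xs]))"
          using ord(1) False by simp
        moreover have "p \<in> set (butlast xs) \<or> p = last xs"
          using that False by (cases xs rule: rev_cases) auto
        ultimately show ?thesis
          unfolding map_append sorted_append c_def by (auto intro: mono)
      qed
      have after: "c \<le> fst p" if "p \<in> set ys" for p
        unfolding c_def using ord(2) that False by (intro mono) (meson last_in_set)
      have "{#p \<in># mset xs. snd p = D#} =
          {#p \<in># mset xs. snd p = D \<and> fst p \<le> c#}"
        by (rule filter_mset_cong) (auto dest: before)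
      also have "\<dots> \<subseteq># {#p \<in># mset ps. snd p = D \<and> fst p \<le> c#}"
        by (simp add: ps)
      finally have "size {#p \<in># mset xs. snd p = D#} \<le>
          size {#p \<in># mset ps. snd p = D \<and> fst p \<le> c#}"
        by (rule size_mset_mono)
      also have "\<dots> \<le> size {#p \<in># mset ps. snd p = U \<and> fst p < c#}"
        using \<open>?blk\<close> by blast
      \<comment> \<open>An auxiliary fact for the next rewriting, not a link of the chain: no up
        step of an earlier block comes after the prefix.\<close>
      also have "{#p \<in># mset ys. snd p = U \<and> fst p < c#} = {#}"
        by (auto dest: after)
      then have "{#p \<in># mset ps. snd p = U \<and> fst p < c#} =
          {#p \<in># mset xs. snd p = U \<and> fst p < c#}"
        by (simp add: ps)
      also have "size \<dots> \<le> size {#p \<in># mset xs. snd p = U#}"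
        by (intro size_mset_mono filter_mset_mono_strong) auto
      finally show ?thesis
        unfolding xs .
    qed (simp only: xs, simp)
  qed
qed

text \<open>The right-hand side is free of \<open>f\<close>, which makes different orders
  comparable. The inverse of the bijection sorts a multiset by \<open>key f\<close> and forgets the
  block numbers.\<close>

lemma card_Des_subset:
  fixes f :: "step \<Rightarrow> nat"
  assumes f: "\<And>x. f x < 3" "f D < f U" "inj f"
  shows "card {M \<in> motzkin_paths n. Des {(x, y). f y < f x} M \<subseteq> S} =
    card {m. image_mset fst m = mset (blocks S n) \<and> block_feasible m}" (is "card ?A = card ?T")
proof -
  let ?g = "\<lambda>M. mset (zip (blocks S n) M)"
  have inj_key: "inj (key f)"
  proof
    fix p q assume eq: "key f p = key f q"
    then have "fst p = fst q"
      using f(1)[of "snd p"] f(1)[of "snd q"] by (simp add: key_def)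
    moreover from this eq have "snd p = snd q"
      using f(3) by (simp add: key_def inj_eq)
    ultimately show "p = q" by (rule prod_eqI)
  qed
  have len: "length M = n" if "M \<in> motzkin_paths n" for M
    using that by (simp add: motzkin_paths_def)
  have motzkin_iff: "M \<in> motzkin_paths n \<longleftrightarrow> block_feasible (?g M)"
    if "length M = n" "Des {(x, y). f y < f x} M \<subseteq> S" for M
    using motzkin_paths_iff[of "zip (blocks S n) M" n]
      sorted_prefix_iff_block_feasible[of f "zip (blocks S n) M"] Des_subset_iff_sorted[of f M S]
      f that by (simp add: block_feasible_def)
  \<comment> \<open>A multiset has only one arrangement that is sorted by an injective key.\<close>
  have "inj_on ?g ?A"
  proof
    fix M N assume M: "M \<in> ?A" and N: "N \<in> ?A" and eq: "?g M = ?g N"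
    have "sorted (map (key f) (zip (blocks S n) M))" "sorted (map (key f) (zip (blocks S n) N))"
      using M N Des_subset_iff_sorted[of f _ S] f(1) len by auto
    moreover have "mset (map (key f) (zip (blocks S n) M)) = mset (map (key f) (zip (blocks S n) N))"
      using eq by simp
    ultimately have "map (key f) (zip (blocks S n) M) = map (key f) (zip (blocks S n) N)"
      by (metis properties_for_sort)
    then have "zip (blocks S n) M = zip (blocks S n) N"
      using inj_key by (simp add: inj_map_eq_map)
    then show "M = N"
      using M N len by (metis (no_types, lifting) length_blocks map_snd_zip mem_Collect_eq)
  qed
  moreover have "?g ` ?A = ?T"
  proof (intro equalityI subsetI)
    fix m assume "m \<in> ?g ` ?A"
    then obtain M where "M \<in> ?A" "m = ?g M" by blast
    then show "m \<in> ?T"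
      using motzkin_iff[of M] len[of M] by (simp flip: mset_map)
  next
    fix m assume m: "m \<in> ?T"
    obtain qs where qs: "mset qs = m" by (metis ex_mset)
    define ps where "ps = sort_key (key f) qs"
    have ps: "mset ps = m" "sorted (map (key f) ps)"
      by (simp_all add: ps_def qs)
    \<comment> \<open>The key compares block numbers first, so after sorting they appear in the
      order of \<open>blocks S n\<close>.\<close>
    have "sorted (map fst ps)"
      unfolding sorted_map
    proof (rule sorted_wrt_mono_rel[OF _ ps(2)[unfolded sorted_map]])
      show "fst p \<le> fst q" if "key f p \<le> key f q" for p q
        using that f(1)[of "snd p"] f(1)[of "snd q"] by (auto simp: key_def)
    qed
    moreover have "mset (map fst ps) = mset (blocks S n)"
      using m ps(1) by simp
    ultimately have fst_ps: "map fst ps = blocks S n"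
      using sorted_blocks by (metis properties_for_sort)
    then have length_ps: "length ps = n"
      by (metis length_blocks length_map)
    have zip: "zip (blocks S n) (map snd ps) = ps"
      by (metis fst_ps zip_map_fst_snd)
    have "Des {(x, y). f y < f x} (map snd ps) \<subseteq> S"
      using Des_subset_iff_sorted[of f "map snd ps" S] f(1) ps(2) zip length_ps by simp
    moreover from this have "map snd ps \<in> motzkin_paths n"
      using motzkin_iff[of "map snd ps"] m ps(1) zip length_ps by simp
    ultimately show "m \<in> ?g ` ?A"
      using zip ps(1) by (intro image_eqI[of _ _ "map snd ps"]) auto
  qed
  ultimately have "bij_betw ?g ?A ?T"
    unfolding bij_betw_def by (rule conjI)
  then show ?thesis
    by (rule bij_betw_same_card)
qed

lemma all_step: "(\<forall>x. P x) \<longleftrightarrow> P U \<and> P D \<and> P L"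
  by (metis step.exhaust)

theorem proposition1p6:
  fixes n :: nat and S :: "nat set"
  assumes "S \<subseteq> {1..n - 1}"
  shows "card {M \<in> motzkin_paths n. Des (order_gt U D L) M = S} =
           card {M \<in> motzkin_paths n. Des (order_gt U L D) M = S}
       \<and> card {M \<in> motzkin_paths n. Des (order_gt U L D) M = S} =
           card {M \<in> motzkin_paths n. Des (order_gt L U D) M = S}"
proof -
  let ?T = "\<lambda>S. {m. image_mset fst m = mset (blocks S n) \<and> block_feasible m}"
  have finS: "finite S"
    using assms by (rule finite_subset) simp
  have count: "card {M \<in> motzkin_paths n. Des r M \<subseteq> S'} = card (?T S')"
    if "r = {(x, y). f y < f x}" "\<And>x. f x < 3" "f D < f U" "inj f" for r S' and f :: "step \<Rightarrow> nat"
    using card_Des_subset[of f n S'] that by simp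
  \<comment> \<open>The arguments of \<open>case_step\<close> are the ranks of \<open>U\<close>,
    \<open>D\<close> and \<open>L\<close>, in this sequence; each of the three choices ranks
    \<open>D\<close> below \<open>U\<close>.\<close>
  have UDL: "card {M \<in> motzkin_paths n. Des (order_gt U D L) M \<subseteq> S'} = card (?T S')" for S'
    by (rule count[of _ "case_step 2 1 0"])
      (simp_all add: order_gt_def inj_def set_eq_iff all_step split: step.split)
  have ULD: "card {M \<in> motzkin_paths n. Des (order_gt U L D) M \<subseteq> S'} = card (?T S')" for S'
    by (rule count[of _ "case_step 2 0 1"])
      (simp_all add: order_gt_def inj_def set_eq_iff all_step split: step.split)
  have LUD: "card {M \<in> motzkin_paths n. Des (order_gt L U D) M \<subseteq> S'} = card (?T S')" for S'
    by (rule count[of _ "case_step 1 0 2"])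
      (simp_all add: order_gt_def inj_def set_eq_iff all_step split: step.split)
  show ?thesis
    by (intro conjI card_fibre_eq_if_card_subset_eq finite_motzkin_paths finS)
      (simp_all only: UDL ULD LUD)
qed

end
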